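(* Let $I=(R,\pi)$ be any interpreted system. Consider the conditions (U) $I\models \overline{fire}\to\overline{start}$, (R) $I\models \overline{fire}\to\bigwedge_{i\in\mathcal A}\lozenge(correct_i\to\overline{fire}_i)$. 1. (U) is fulfilled if $I\models\bigwedge_{i\in\mathcal A}\bigl(\neg B_i\,\overline{start}\to\neg\overline{fire}_i\bigr)$. 2. Both (U) and (R) are fulfilled if $$I\models\bigwedge_{i\in\mathcal A}\Bigl(\bigl(\neg B_i(\overline{start}\wedge C^{\lozenge H}\,\overline{start})\to\neg\overline{fire}_i\bigr)\wedge\bigl(B_i(\overline{start}\wedge C^{\lozenge H}\,\overline{start})\to\lozenge(correct_i\to\overline{fire}_i)\bigr)\Bigr).$$
   Context: Model. $\mathcal A=\{1,\dots,n\}$ is a finite set of agents; time ranges over $\mathbb N$. A run $r$ assigns to each $t\in\mathbb N$ a global state $r(t)=(r_\epsilon(t),r_1(t),\dots,r_n(t))$ consisting of the environment state and the local state (local history) $r_i(t)$ of each agent $i$. Agents may become byzantine faulty. An interpreted system is a pair $I=(R,\pi)$ with $R$ a set of runs and $\pi$ a valuation of atomic propositions at points $(r,t)$, $r\in R$, $t\in\mathbb N$. Agents are asynchronous (a local state may stay unchanged over several rounds) and have perfect recall: recorded actions/events are never removed from a local history, and if $r_i(t)=r'_i(t')$ and $s\le t$ then there is $s'\le t'$ with $r'_i(s')=r_i(s)$. Formulas are built from atomic propositions by Boolean connectives, $K_i$ ($i\in\mathcal A$), $\lozenge$, $Y$, with $\Box\varphi:=\neg\lozenge\neg\varphi$.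 Semantics: $(I,r,t)\models K_i\varphi$ iff $(I,r',t')\models\varphi$ for all $r'\in R$, $t'\in\mathbb N$ with $r_i(t)=r'_i(t')$; $(I,r,t)\models\lozenge\varphi$ iff $(I,r,t')\models\varphi$ for some $t'\ge t$; $(I,r,t)\models Y\varphi$ iff $t>0$ and $(I,r,t-1)\models\varphi$. $I\models\varphi$ means $\varphi$ holds at all points $(r,t)$ with $r\in R$, $t\in\mathbb N$. Designated atoms: $correct_i$ holds at $(r,t)$ iff no faulty event happened to $i$ in $r$ by time $t$ (so once false in a run it stays false). For an action/event $o\in\{\mathrm{START},\mathrm{FIRE}\}$, $\overline{occurred}_i(o)$ holds at $(r,t)$ iff $r_i(t)$ contains an accurate record of $o$ occurring; whether $r_i(t)$ contains a record of $o$ depends only on the local state $r_i(t)$, and if $correct_i$ holds at $(r,t)$ then every record in $r_i(t)$ is accurate. Abbreviations: $\overline{start}_i:=Y\,\overline{occurred}_i(\mathrm{START})\wedge correct_i$; $\overline{fire}_i:=\overline{occurred}_i(\mathrm{FIRE})\wedge correct_i$; $\overline{start}:=\bigvee_{j\in\mathcal A}\overline{start}_j$; $\overline{fire}:=\bigvee_{j\in\mathcal A}\overline{fire}_j$. Belief: $B_i\varphi:=K_i(correct_i\to\varphi)$. Hope: $H_i\varphi:=correct_i\to B_i\varphi$. Eventual mutual hope: $E^{\lozenge H}\varphi:=\bigwedge_{j\in\mathcal A}\lozenge H_j\varphi$. Eventual common hope $C^{\lozenge H}\varphi$ is the greatest fixed point of $\chi\leftrightarrow E^{\lozenge H}(\varphi\wedge\chi)$,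 i.e. it holds exactly on the greatest set $X$ of points such that $X$ equals the set of points satisfying $E^{\lozenge H}(\varphi\wedge\chi)$ when $\chi$ is interpreted as $X$. *)

theory Defs
  imports Main
begin

text \<open>
  The agents are the elements of a type \<open>'i\<close>, which is required to be finite from the locale below on;
  \<open>'e\<close> and \<open>'l\<close> are the environment states and the local states (local histories).
\<close>

type_synonym ('i, 'e, 'l) run = "nat \<Rightarrow> 'e \<times> ('i \<Rightarrow> 'l)"

definition loc :: "('i, 'e, 'l) run \<Rightarrow> 'i \<Rightarrow> nat \<Rightarrow> 'l" where
  "loc r i t = snd (r t) i"

datatype 'h hap = START | FIRE | Other 'h

datatype ('i, 'h, 'p) atom = Correct 'i | Occurred 'i "'h hap" | Prop 'p

text \<open>
  \<open>Conj F\<close> is the conjunction of the \<open>F i\<close> over all agents \<open>i\<close>, a finite conjunction.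
  \<open>CEH\<close> is eventual common hope; it has to be primitive, because it is a fixed point.
\<close>

datatype ('i, 'h, 'p) fm =
    Atom "('i, 'h, 'p) atom"
  | Neg "('i, 'h, 'p) fm"
  | And "('i, 'h, 'p) fm" "('i, 'h, 'p) fm"
  | Conj "'i \<Rightarrow> ('i, 'h, 'p) fm"
  | Know 'i "('i, 'h, 'p) fm"
  | Ev "('i, 'h, 'p) fm"
  | Yest "('i, 'h, 'p) fm"
  | CEH "('i, 'h, 'p) fm"

definition Imp :: "('i, 'h, 'p) fm \<Rightarrow> ('i, 'h, 'p) fm \<Rightarrow> ('i, 'h, 'p) fm" where
  "Imp \<phi> \<psi> = Neg (And \<phi> (Neg \<psi>))"

definition Disj :: "('i \<Rightarrow> ('i, 'h, 'p) fm) \<Rightarrow> ('i, 'h, 'p) fm" where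
  "Disj F = Neg (Conj (\<lambda>i. Neg (F i)))"

definition correct :: "'i \<Rightarrow> ('i, 'h, 'p) fm" where
  "correct i = Atom (Correct i)"

definition occurred :: "'i \<Rightarrow> 'h hap \<Rightarrow> ('i, 'h, 'p) fm" where
  "occurred i h = Atom (Occurred i h)"

definition start_ag :: "'i \<Rightarrow> ('i, 'h, 'p) fm" where
  "start_ag i = And (Yest (occurred i START)) (correct i)"

definition fire_ag :: "'i \<Rightarrow> ('i, 'h, 'p) fm" where
  "fire_ag i = And (occurred i FIRE) (correct i)"

definition start :: "('i, 'h, 'p) fm" where
  "start = Disj start_ag"

definition fire :: "('i, 'h, 'p) fm" where
  "fire = Disj fire_ag"

definition Bel :: "'i \<Rightarrow> ('i, 'h, 'p) fm \<Rightarrow> ('i, 'h, 'p) fm" where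
  "Bel i \<phi> = Know i (Imp (correct i) \<phi>)"

definition Hope :: "'i \<Rightarrow> ('i, 'h, 'p) fm \<Rightarrow> ('i, 'h, 'p) fm" where
  "Hope i \<phi> = Imp (correct i) (Bel i \<phi>)"

definition EH :: "('i, 'h, 'p) fm \<Rightarrow> ('i, 'h, 'p) fm" where
  "EH \<phi> = Conj (\<lambda>j. Ev (Hope j \<phi>))"

record ('i, 'e, 'l, 'h, 'p) isys =
  runs :: "('i, 'e, 'l) run set"
  val :: "('i, 'h, 'p) atom \<Rightarrow> ('i, 'e, 'l) run \<Rightarrow> nat \<Rightarrow> bool"

text \<open>
  The modalities as operators on predicates of points. The operator \<open>eh_at\<close> is the semantic
  counterpart of \<open>EH\<close> (lemma \<open>sat_EH\<close> below); it is needed to interpret the fixed point variable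
  in the equation defining \<open>CEH\<close> by an arbitrary set of points.
\<close>

definition know_at :: "('i, 'e, 'l, 'h, 'p) isys \<Rightarrow> 'i
    \<Rightarrow> (('i, 'e, 'l) run \<Rightarrow> nat \<Rightarrow> bool) \<Rightarrow> ('i, 'e, 'l) run \<Rightarrow> nat \<Rightarrow> bool" where
  "know_at I i P r t \<longleftrightarrow> (\<forall>r'\<in>runs I. \<forall>t'. loc r i t = loc r' i t' \<longrightarrow> P r' t')"

definition hope_at :: "('i, 'e, 'l, 'h, 'p) isys \<Rightarrow> 'i
    \<Rightarrow> (('i, 'e, 'l) run \<Rightarrow> nat \<Rightarrow> bool) \<Rightarrow> ('i, 'e, 'l) run \<Rightarrow> nat \<Rightarrow> bool" where
  "hope_at I i P r t \<longleftrightarrow>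
     (val I (Correct i) r t \<longrightarrow> know_at I i (\<lambda>r' t'. val I (Correct i) r' t' \<longrightarrow> P r' t') r t)"

definition eh_at :: "('i, 'e, 'l, 'h, 'p) isys
    \<Rightarrow> (('i, 'e, 'l) run \<Rightarrow> nat \<Rightarrow> bool) \<Rightarrow> ('i, 'e, 'l) run \<Rightarrow> nat \<Rightarrow> bool" where
  "eh_at I P r t \<longleftrightarrow> (\<forall>j. \<exists>t'\<ge>t. hope_at I j P r t')"

primrec sat :: "('i, 'e, 'l, 'h, 'p) isys \<Rightarrow> ('i, 'h, 'p) fm \<Rightarrow> ('i, 'e, 'l) run \<Rightarrow> nat \<Rightarrow> bool" where
  "sat I (Atom p) = (\<lambda>r t. val I p r t)"
| "sat I (Neg \<phi>) = (\<lambda>r t. \<not> sat I \<phi> r t)"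
| "sat I (And \<phi> \<psi>) = (\<lambda>r t. sat I \<phi> r t \<and> sat I \<psi> r t)"
| "sat I (Conj F) = (\<lambda>r t. \<forall>i. sat I (F i) r t)"
| "sat I (Know i \<phi>) = (\<lambda>r t. know_at I i (sat I \<phi>) r t)"
| "sat I (Ev \<phi>) = (\<lambda>r t. \<exists>t'\<ge>t. sat I \<phi> r t')"
| "sat I (Yest \<phi>) = (\<lambda>r t. t > 0 \<and> sat I \<phi> r (t - 1))"
| "sat I (CEH \<phi>) = (\<lambda>r t. (r, t) \<in>
     gfp (\<lambda>X. {(r, t). r \<in> runs I \<and> eh_at I (\<lambda>r' t'. sat I \<phi> r' t' \<and> (r', t') \<in> X) r t}))"

definition valid :: "('i, 'e, 'l, 'h, 'p) isys \<Rightarrow> ('i, 'h, 'p) fm \<Rightarrow> bool" (infix "\<Turnstile>" 50) where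
  "I \<Turnstile> \<phi> \<longleftrightarrow> (\<forall>r\<in>runs I. \<forall>t. sat I \<phi> r t)"

lemma sat_EH: "sat I (EH \<phi>) r t \<longleftrightarrow> eh_at I (sat I \<phi>) r t"
proof -
  have "sat I (Imp \<psi> \<chi>) = (\<lambda>r t. sat I \<psi> r t \<longrightarrow> sat I \<chi> r t)" for \<psi> \<chi>
    by (simp add: Imp_def)
  then show ?thesis
    by (simp add: EH_def eh_at_def hope_at_def Hope_def Bel_def correct_def)
qed

text \<open>
  The operator in the clause for \<open>CEH\<close> is monotone, so that its \<open>gfp\<close> is the greatest set of
  points that is equal to its own image.
\<close>

lemma mono_CEH:
  "mono (\<lambda>X. {(r, t). r \<in> runs I \<and> eh_at I (\<lambda>r' t'. sat I \<phi> r' t' \<and> (r', t') \<in> X) r t})"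
  by (rule monoI) (auto simp: eh_at_def hope_at_def know_at_def; blast)

lemma CEH_fixed_point: "r \<in> runs I \<Longrightarrow> sat I (CEH \<phi>) r t \<longleftrightarrow> sat I (EH (And \<phi> (CEH \<phi>))) r t"
  unfolding sat_EH sat.simps by (subst gfp_unfold[OF mono_CEH]) simp

lemma CEH_greatest:
  assumes "X = {(r, t). r \<in> runs I \<and> eh_at I (\<lambda>r' t'. sat I \<phi> r' t' \<and> (r', t') \<in> X) r t}"
  shows "X \<subseteq> {(r, t). r \<in> runs I \<and> sat I (CEH \<phi>) r t}"
proof -
  have "X \<subseteq> gfp (\<lambda>X. {(r, t). r \<in> runs I \<and> eh_at I (\<lambda>r' t'. sat I \<phi> r' t' \<and> (r', t') \<in> X) r t})"
    by (rule gfp_upperbound) (rule equalityD1[OF assms])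
  then show ?thesis
    using assms by auto
qed

text \<open>
  \<open>recs l\<close> is the set of records in a local state \<open>l\<close>; a record \<open>(x, h)\<close> is a record of the
  action/event \<open>h\<close>, where \<open>x\<close> distinguishes several records of the same \<open>h\<close> (for instance by
  their positions in a history). \<open>faulty r s i\<close> says that a faulty event happens to \<open>i\<close> in \<open>r\<close> at
  time \<open>s\<close>, and \<open>accurate r t i\<close> singles out the accurate records of \<open>i\<close> at \<open>(r, t)\<close>.
  Agents are asynchronous: nothing forces a local state to change from one time to the next.
\<close>

locale byzantine_system =
  fixes recs :: "'l \<Rightarrow> ('x \<times> 'h hap) set"
    and faulty :: "('i::finite, 'e, 'l) run \<Rightarrow> nat \<Rightarrow> 'i \<Rightarrow> bool"
    and accurate :: "('i, 'e, 'l) run \<Rightarrow> nat \<Rightarrow> 'i \<Rightarrow> 'x \<times> 'h hap \<Rightarrow> bool"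
    and I :: "('i, 'e, 'l, 'h, 'p) isys"
  assumes records_kept:
      "r \<in> runs I \<Longrightarrow> s \<le> t \<Longrightarrow> recs (loc r i s) \<subseteq> recs (loc r i t)"
    and perfect_recall:
      "r \<in> runs I \<Longrightarrow> r' \<in> runs I \<Longrightarrow> loc r i t = loc r' i t' \<Longrightarrow> s \<le> t
         \<Longrightarrow> \<exists>s'\<le>t'. loc r' i s' = loc r i s"
    and val_correct:
      "r \<in> runs I \<Longrightarrow> val I (Correct i) r t \<longleftrightarrow> (\<forall>s\<le>t. \<not> faulty r s i)"
    and val_occurred:
      "r \<in> runs I \<Longrightarrow> h \<in> {START, FIRE} \<Longrightarrow>
         val I (Occurred i h) r t \<longleftrightarrow> (\<exists>x. (x, h) \<in> recs (loc r i t) \<and> accurate r t i (x, h))"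
    and correct_imp_accurate:
      "r \<in> runs I \<Longrightarrow> val I (Correct i) r t \<Longrightarrow> y \<in> recs (loc r i t) \<Longrightarrow> accurate r t i y"

end

theory Submission
  imports Defs
begin

text \<open>
  A correct agent that fires holds the belief in the firing condition, and beliefs of correct agents
  are true; this gives (U), and in part 2 also \<open>C\<^sup>\<lozenge>\<^sup>H start\<close>. Unfolding this fixed point once, every agent
  \<open>i\<close> eventually hopes \<open>start \<and> C\<^sup>\<lozenge>\<^sup>H start\<close>: at that later time \<open>i\<close> is either incorrect, so that
  \<open>correct\<^sub>i \<longrightarrow> fire\<^sub>i\<close> is vacuous, or holds the belief that makes it fire eventually.
\<close>

lemma sat_Imp [simp]: "sat I (Imp \<phi> \<psi>) r t \<longleftrightarrow> (sat I \<phi> r t \<longrightarrow> sat I \<psi> r t)"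
  by (simp add: Imp_def)

lemma sat_Disj [simp]: "sat I (Disj F) r t \<longleftrightarrow> (\<exists>i. sat I (F i) r t)"
  by (simp add: Disj_def)

lemma sat_Hope: "sat I (Hope i \<phi>) r t \<longleftrightarrow> (sat I (correct i) r t \<longrightarrow> sat I (Bel i \<phi>) r t)"
  by (simp add: Hope_def)

text \<open>The point \<open>(r, t)\<close> has the same local state as itself, so it is among those
  quantified over by \<open>know_at\<close>; correctness there discharges the guard inside
  \<open>Bel\<close>.\<close>

lemma Bel_factive:
  assumes "r \<in> runs I" "sat I (correct i) r t" "sat I (Bel i \<phi>) r t"
  shows "sat I \<phi> r t"
  using assms by (auto simp: Bel_def know_at_def)

text \<open>Kept general in \<open>\<phi>\<close> to serve both parts: \<open>start\<close> for the
  first, \<open>And start (CEH start)\<close> for the second.\<close>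

lemma fire_imp_if_Bel_necessary:
  assumes nec: "I \<Turnstile> Conj (\<lambda>i. Imp (Neg (Bel i \<phi>)) (Neg (fire_ag i)))"
  shows "I \<Turnstile> Imp fire \<phi>"
  unfolding valid_def
proof (intro ballI allI)
  fix r t
  assume r: "r \<in> runs I"
  have "sat I \<phi> r t" if "sat I (fire_ag j) r t" for j
  proof (rule Bel_factive[OF r])
    show "sat I (correct j) r t"
      using that by (simp add: fire_ag_def)
    show "sat I (Bel j \<phi>) r t"
      using nec r that by (auto simp: valid_def)
  qed
  then show "sat I (Imp fire \<phi>) r t"
    by (auto simp: fire_def)
qed

lemma CEH_imp_eventually_if_Bel_sufficient:
  assumes suf: "I \<Turnstile> Conj (\<lambda>i. Imp (Bel i (And \<phi> (CEH \<phi>))) (Ev (Imp (correct i) (\<psi> i))))"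
  shows "I \<Turnstile> Imp (CEH \<phi>) (Conj (\<lambda>i. Ev (Imp (correct i) (\<psi> i))))"
proof -
  have "\<exists>t'\<ge>t. sat I (Imp (correct i) (\<psi> i)) r t'"
    if r: "r \<in> runs I" and C: "sat I (CEH \<phi>) r t" for r t i
  proof -
    \<comment> \<open>\<open>u\<close> is the witness of \<open>Ev\<close> in agent
      \<open>i\<close>'s conjunct of \<open>EH\<close>. Dropping \<open>sat.simps(8)\<close>, the
      \<open>gfp\<close> clause, keeps the inner \<open>CEH\<close> folded, in the form that
      \<open>suf\<close> expects.\<close>
    obtain u where u: "u \<ge> t" "sat I (Hope i (And \<phi> (CEH \<phi>))) r u"
      using C unfolding CEH_fixed_point[OF r] EH_def by (auto simp del: sat.simps(8))
    show ?thesis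
    proof (cases "sat I (correct i) r u")
      case True
      then have "sat I (Bel i (And \<phi> (CEH \<phi>))) r u"
        using u(2) by (simp only: sat_Hope)
      then have "sat I (Ev (Imp (correct i) (\<psi> i))) r u"
        using suf r by (simp add: valid_def del: sat.simps(8))
      then show ?thesis
        using u(1) order_trans by (auto simp del: sat.simps(8))
    next
      case False
      then show ?thesis
        using u(1) by auto
    qed
  qed
  then show ?thesis
    by (simp add: valid_def del: sat.simps(8))
qed

theorem theorem16:
  fixes recs :: "'l \<Rightarrow> ('x \<times> 'h hap) set"
    and faulty :: "('i::finite, 'e, 'l) run \<Rightarrow> nat \<Rightarrow> 'i \<Rightarrow> bool"
    and accurate :: "('i, 'e, 'l) run \<Rightarrow> nat \<Rightarrow> 'i \<Rightarrow> 'x \<times> 'h hap \<Rightarrow> bool"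
    and I :: "('i, 'e, 'l, 'h, 'p) isys"
  assumes "byzantine_system recs faulty accurate I"
  shows
    "(I \<Turnstile> Conj (\<lambda>i. Imp (Neg (Bel i start)) (Neg (fire_ag i)))
        \<longrightarrow> I \<Turnstile> Imp fire start)
     \<and>
     (I \<Turnstile> Conj (\<lambda>i. And
            (Imp (Neg (Bel i (And start (CEH start)))) (Neg (fire_ag i)))
            (Imp (Bel i (And start (CEH start))) (Ev (Imp (correct i) (fire_ag i)))))
        \<longrightarrow> I \<Turnstile> Imp fire start
          \<and> I \<Turnstile> Imp fire (Conj (\<lambda>i. Ev (Imp (correct i) (fire_ag i)))))"
proof (intro conjI impI)
  assume "I \<Turnstile> Conj (\<lambda>i. Imp (Neg (Bel i start)) (Neg (fire_ag i)))"
  then show "I \<Turnstile> Imp fire start"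
    by (rule fire_imp_if_Bel_necessary)
next
  let ?\<phi> = "And start (CEH start)"
  assume "I \<Turnstile> Conj (\<lambda>i. And
    (Imp (Neg (Bel i ?\<phi>)) (Neg (fire_ag i)))
    (Imp (Bel i ?\<phi>) (Ev (Imp (correct i) (fire_ag i)))))"
  then have nec: "I \<Turnstile> Conj (\<lambda>i. Imp (Neg (Bel i ?\<phi>)) (Neg (fire_ag i)))"
    and suf: "I \<Turnstile> Conj (\<lambda>i. Imp (Bel i ?\<phi>) (Ev (Imp (correct i) (fire_ag i))))"
    by (simp_all add: valid_def del: sat.simps(8))
  \<comment> \<open>The first conjunct of \<open>?\<phi>\<close> is (U); the second is the premise
    from which \<open>suf\<close> yields (R).\<close>
  have fire: "I \<Turnstile> Imp fire ?\<phi>"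
    using nec by (rule fire_imp_if_Bel_necessary)
  then show "I \<Turnstile> Imp fire start"
    by (simp add: valid_def del: sat.simps(8))
  show "I \<Turnstile> Imp fire (Conj (\<lambda>i. Ev (Imp (correct i) (fire_ag i))))"
    using fire CEH_imp_eventually_if_Bel_sufficient[OF suf]
    by (simp add: valid_def del: sat.simps(8))
qed

end
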